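(* Let $\mathbb{F}$ be an algebraically closed field with $\mathrm{Char}(\mathbb{F})\neq 2$, let $p\in\mathbb{F}$ with $p\ne 0$, $p\neq 1$, and let $N$ be a feasible integer. Let $U,B,D,K$ be the matrices in $\mathrm{Mat}_{N+1}(\mathbb{F})$, with rows and columns indexed by $0,1,\ldots,N$, defined as follows. $U$ has $(i,j)$-entry $K_i(j)$, where $K_i=K_i(x;p,N)$ is the $i$th Krawtchouk polynomial. $B$ is tridiagonal with $B_{i,i-1}=c_i$ $(1\le i\le N)$, $B_{i,i}=a_i$ $(0\le i\le N)$, $B_{i,i+1}=b_i$ $(0\le i\le N-1)$, where $c_i=i(p-1)$, $b_i=(i-N)p$, $a_i=-b_i-c_i$. $D=\mathrm{diag}(0,1,\ldots,N)$. $K=\mathrm{diag}(k_0,k_1,\ldots,k_N)$ with $k_i=\binom{N}{i}\left(\frac{p}{1-p}\right)^i$. Let $P=UK$. Then: (i) $P^t=KPK^{-1}$. (ii) $B^t=KBK^{-1}$. (iii) $PD=BP$. (iv) $PB=DP$. (v) $P^2=(1-p)^{-N}I$.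
   Context: An integer $N$ is feasible if $N\ge 0$ when $\mathrm{Char}(\mathbb{F})=0$, and $0\le N<\mathrm{Char}(\mathbb{F})$ when $\mathrm{Char}(\mathbb{F})>0$. $M^t$ denotes the transpose of $M$. With $(\alpha)_n=\alpha(\alpha+1)\cdots(\alpha+n-1)$, $(\alpha)_0=1$, the Krawtchouk polynomials with parameters $p$ and $N$ are the polynomials in $\mathbb{F}[x]$ $$K_i(x)=K_i(x;p,N)=\sum_{n=0}^{i}\frac{(-i)_n(-x)_n}{(-N)_n\,n!}\,p^{-n},\qquad i=0,1,\ldots,N.$$ *)

theory Defs
  imports
    "HOL-Computational_Algebra.Computational_Algebra"
    "Jordan_Normal_Form.Gauss_Jordan_Elimination"
begin

(* CHAR('a) is 0 exactly when the field has characteristic zero. *)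
definition feasible :: "'a::field itself \<Rightarrow> nat \<Rightarrow> bool" where
  "feasible _ N \<longleftrightarrow> CHAR('a) = 0 \<or> N < CHAR('a)"

(* The factor (-x)_n is a rising factorial taken in the polynomial ring, with x = [:0, 1:]. *)
definition krawtchouk :: "'a::field \<Rightarrow> nat \<Rightarrow> nat \<Rightarrow> 'a poly" where
  "krawtchouk p N i =
     (\<Sum>n = 0..i.
        Polynomial.smult (pochhammer (- of_nat i) n / (pochhammer (- of_nat N) n * of_nat (fact n))
                 * p powi (- int n))
              (pochhammer (- [:0, 1:]) n))"

definition kraw_c :: "'a::field \<Rightarrow> nat \<Rightarrow> 'a" where
  "kraw_c p i = of_nat i * (p - 1)"

definition kraw_b :: "'a::field \<Rightarrow> nat \<Rightarrow> nat \<Rightarrow> 'a" where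
  "kraw_b p N i = (of_nat i - of_nat N) * p"

definition kraw_a :: "'a::field \<Rightarrow> nat \<Rightarrow> nat \<Rightarrow> 'a" where
  "kraw_a p N i = - kraw_b p N i - kraw_c p i"

definition kraw_k :: "'a::field \<Rightarrow> nat \<Rightarrow> nat \<Rightarrow> 'a" where
  "kraw_k p N i = of_nat (N choose i) * (p / (1 - p)) ^ i"

definition U_mat :: "'a::field \<Rightarrow> nat \<Rightarrow> 'a mat" where
  "U_mat p N = mat (N + 1) (N + 1) (\<lambda>(i, j). poly (krawtchouk p N i) (of_nat j))"

definition B_mat :: "'a::field \<Rightarrow> nat \<Rightarrow> 'a mat" where
  "B_mat p N = mat (N + 1) (N + 1)
     (\<lambda>(i, j). if i = j + 1 then kraw_c p i
               else if i = j then kraw_a p N i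
               else if j = i + 1 then kraw_b p N i
               else 0)"

definition D_mat :: "nat \<Rightarrow> 'a::field mat" where
  "D_mat N = mat_diag (N + 1) of_nat"

definition K_mat :: "'a::field \<Rightarrow> nat \<Rightarrow> 'a mat" where
  "K_mat p N = mat_diag (N + 1) (kraw_k p N)"

end

theory Submission
  imports Defs
begin

text \<open>
  On the grid the truncated sum $K_i(j)$ may be extended to $n \le N$, which makes $U$ symmetric;
  together with $k_i b_i = k_{i+1} c_{i+1}$ this gives (i) and (ii). The three-term recurrence
  $BU = UD$ yields (iii), and (iv) is its transpose conjugated by $K$. By (iii) and (iv) the matrix
  $P^2$ commutes with $D$, which has distinct diagonal entries, and with the tridiagonal matrix $B$,
  whose superdiagonal has no zero. So $P^2$ is scalar, and its $(0,0)$ entry is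
  $\sum_j k_j = (1 + p/(1-p))^N = (1-p)^{-N}$.
\<close>

section \<open>Feasible integers\<close>

lemma feasible_of_nat_neq_0:
  assumes "feasible TYPE('a::field) N" "0 < m" "m \<le> N"
  shows "(of_nat m :: 'a) \<noteq> 0"
proof
  assume "(of_nat m :: 'a) = 0"
  then have "CHAR('a) dvd m" by (simp add: of_nat_eq_0_iff_char_dvd)
  with assms show False
    by (auto simp: feasible_def dest: dvd_imp_le)
qed

lemma feasible_of_nat_eq_iff:
  assumes "feasible TYPE('a::field) N" "i \<le> N" "j \<le> N"
  shows "(of_nat i :: 'a) = of_nat j \<longleftrightarrow> i = j"
proof -
  have "(of_nat i :: 'a) \<noteq> of_nat j" if "i < j" "j \<le> N" for i j
    using feasible_of_nat_neq_0[OF assms(1), of "j - i"] that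
    by (simp add: of_nat_diff diff_le_self[THEN order_trans])
  from this[of i j] this[of j i] assms show ?thesis
    by (metis linorder_neqE_nat)
qed

lemma feasible_fact_neq_0:
  assumes "feasible TYPE('a::field) N" "n \<le> N"
  shows "(of_nat (fact n) :: 'a) \<noteq> 0"
  using assms(2)
proof (induction n)
  case (Suc n)
  then show ?case
    using feasible_of_nat_neq_0[OF assms(1), of "Suc n"] by (simp only: fact_Suc of_nat_mult) auto
qed simp

lemma feasible_pochhammer_neq_0:
  assumes "feasible TYPE('a::field) N" "n \<le> N"
  shows "pochhammer (- of_nat N :: 'a) n \<noteq> 0"
proof
  assume "pochhammer (- of_nat N :: 'a) n = 0"
  then obtain k where "k < n" "(of_nat N :: 'a) = of_nat k"
    by (auto simp: pochhammer_prod)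
  with assms feasible_of_nat_eq_iff[OF assms(1), of N k] show False by simp
qed

lemma feasible_binomial_neq_0:
  assumes "feasible TYPE('a::field) N" "i \<le> N"
  shows "(of_nat (N choose i) :: 'a) \<noteq> 0"
proof -
  have "of_nat (fact i * fact (N - i) * (N choose i)) = (of_nat (fact N) :: 'a)"
    using binomial_fact_lemma[OF assms(2)] by simp
  then show ?thesis
    using feasible_fact_neq_0[OF assms(1) order_refl] by auto
qed

section \<open>Krawtchouk polynomials\<close>

definition kraw_term :: "'a::field \<Rightarrow> nat \<Rightarrow> 'a \<Rightarrow> 'a \<Rightarrow> nat \<Rightarrow> 'a" where
  "kraw_term p N x y n =
     pochhammer (- x) n * pochhammer (- y) n / (pochhammer (- of_nat N) n * of_nat (fact n) * p ^ n)"

lemma poly_pochhammer: "poly (pochhammer q n) x = pochhammer (poly q x) n"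
  by (induction n) (simp_all add: pochhammer_Suc)

lemma poly_krawtchouk:
  assumes "i \<le> N"
  shows "poly (krawtchouk p N i) x = (\<Sum>n = 0..N. kraw_term p N (of_nat i) x n)"
proof -
  have "poly (krawtchouk p N i) x = (\<Sum>n = 0..i. kraw_term p N (of_nat i) x n)"
    unfolding krawtchouk_def kraw_term_def
    by (simp add: poly_sum poly_pochhammer power_int_minus divide_simps)
  also have "\<dots> = (\<Sum>n = 0..N. kraw_term p N (of_nat i) x n)"
    using assms
    by (intro sum.mono_neutral_left) (auto simp: kraw_term_def pochhammer_of_nat_eq_0_lemma)
  finally show ?thesis .
qed

text \<open>
  The difference of the two sides of the recurrence telescopes; at the grid points $y = 0, \ldots, N$
  the remaining factor \<open>pochhammer (- y) (Suc M)\<close> vanishes for $M = N$.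
\<close>

lemma kraw_term_recurrence_partial:
  fixes p x y :: "'a::field"
  assumes "feasible TYPE('a) N" "p \<noteq> 0" "M \<le> N"
  defines "c \<equiv> x * (p - 1)" and "b \<equiv> (x - of_nat N) * p"
  shows "(\<Sum>n = 0..M. c * kraw_term p N (x - 1) y n + (- b - c) * kraw_term p N x y n
            + b * kraw_term p N (x + 1) y n - y * kraw_term p N x y n)
       = pochhammer (- x) M * pochhammer (- y) (Suc M)
           / (pochhammer (- of_nat N) M * of_nat (fact M) * p ^ M)"
  using assms(3)
proof (induction M)
  case 0
  show ?case by (simp add: kraw_term_def algebra_simps)
next
  case (Suc M)
  define m n' :: 'a where "m = of_nat M" and "n' = of_nat N"
  define A Y Q where "A = pochhammer (- x) M" and "Y = pochhammer (- y) M"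
    and "Q = pochhammer (- of_nat N :: 'a) M * of_nat (fact M) * p ^ M"
  have "Q \<noteq> 0"
    using Suc.prems assms(2) feasible_fact_neq_0[OF assms(1), of M]
      feasible_pochhammer_neq_0[OF assms(1), of M] by (simp add: Q_def)
  moreover have "m - n' \<noteq> 0"
    using Suc.prems feasible_of_nat_eq_iff[OF assms(1), of M N] by (simp add: m_def n'_def)
  moreover have "m + 1 \<noteq> 0"
    using Suc.prems feasible_of_nat_neq_0[OF assms(1), of "Suc M"] by (simp add: m_def add.commute)
  ultimately have Q: "Q \<noteq> 0" "m - n' \<noteq> 0" "m + 1 \<noteq> 0" by blast+
  have den: "pochhammer (- of_nat N :: 'a) (Suc M) * of_nat (fact (Suc M)) * p ^ Suc M
      = Q * (m - n') * (m + 1) * p"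
    by (simp add: Q_def m_def n'_def pochhammer_Suc algebra_simps)
  have px: "pochhammer (- x) (Suc M) = A * (m - x)"
    by (simp add: A_def m_def pochhammer_Suc algebra_simps)
  have py: "pochhammer (- y) (Suc M) = Y * (m - y)"
    by (simp add: Y_def m_def pochhammer_Suc algebra_simps)
  have py': "pochhammer (- y) (Suc (Suc M)) = Y * (m - y) * (m + 1 - y)"
    by (subst pochhammer_Suc) (simp add: py m_def algebra_simps)
  have pp: "pochhammer (- (x + 1)) (Suc M) = (- x - 1) * A"
    by (simp add: A_def pochhammer_rec algebra_simps)
  have pm: "x * pochhammer (- (x - 1)) (Suc M) = - A * (m - x) * (m + 1 - x)"
  proof -
    have "(- x) * pochhammer (- x + 1) (Suc M) = pochhammer (- x) (Suc (Suc M))"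
      by (simp add: pochhammer_rec)
    also have "\<dots> = A * (m - x) * (m + 1 - x)"
      by (subst pochhammer_Suc) (simp add: px m_def algebra_simps)
    finally show ?thesis by (simp add: algebra_simps)
  qed
  define W where "W = A * (Y * (m - y)) / (Q * (m - n') * (m + 1) * p)"
  have t0: "A * (Y * (m - y)) / Q = W * ((m - n') * (m + 1) * p)"
    using Q assms(2) by (simp add: W_def)
  have t1: "c * kraw_term p N (x - 1) y (Suc M) = W * - ((p - 1) * ((m - x) * (m + 1 - x)))"
  proof -
    have "c * kraw_term p N (x - 1) y (Suc M) = (p - 1) * (x * pochhammer (- (x - 1)) (Suc M))
        * (Y * (m - y)) / (Q * (m - n') * (m + 1) * p)"
      unfolding kraw_term_def den py c_def by (simp add: mult_ac)
    then show ?thesis unfolding pm W_def by (simp add: mult_ac)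
  qed
  have t2: "kraw_term p N x y (Suc M) = W * (m - x)"
    unfolding kraw_term_def den py px W_def by (simp add: mult_ac)
  have t3: "kraw_term p N (x + 1) y (Suc M) = W * (- x - 1)"
    unfolding kraw_term_def den py pp W_def by (simp add: mult_ac)
  have rhs: "pochhammer (- x) (Suc M) * pochhammer (- y) (Suc (Suc M))
      / (pochhammer (- of_nat N) (Suc M) * of_nat (fact (Suc M)) * p ^ Suc M)
      = W * ((m - x) * (m + 1 - y))"
    unfolding den px py' W_def by (simp add: mult_ac)
  have IH: "(\<Sum>n = 0..M. c * kraw_term p N (x - 1) y n + (- b - c) * kraw_term p N x y n
            + b * kraw_term p N (x + 1) y n - y * kraw_term p N x y n)
      = W * ((m - n') * (m + 1) * p)"
    using Suc unfolding t0[symmetric] by (simp add: A_def Q_def flip: py)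
  have core: "(m - n') * (m + 1) * p + - ((p - 1) * ((m - x) * (m + 1 - x)))
      + (- b - c) * (m - x) + b * (- x - 1) - y * (m - x) = (m - x) * (m + 1 - y)"
    unfolding b_def c_def n'_def[symmetric] by (simp add: algebra_simps)
  have factor: "W * t + (W * u + d * (W * v) + e * (W * w) - y * (W * v))
      = W * (t + u + d * v + e * w - y * v)" for t u v w d e :: 'a
    by (simp add: algebra_simps)
  show ?case
    unfolding sum.atLeast0_atMost_Suc IH t1 t2 t3 rhs factor core ..
qed

lemma kraw_term_recurrence:
  fixes p x :: "'a::field"
  assumes "feasible TYPE('a) N" "p \<noteq> 0" "j \<le> N"
  defines "c \<equiv> x * (p - 1)" and "b \<equiv> (x - of_nat N) * p"
    and "S \<equiv> \<lambda>z. \<Sum>n = 0..N. kraw_term p N z (of_nat j) n"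
  shows "c * S (x - 1) + (- b - c) * S x + b * S (x + 1) = of_nat j * S x"
proof -
  have "pochhammer (- of_nat j :: 'a) (Suc N) = 0"
    using assms(3) by (simp add: pochhammer_of_nat_eq_0_lemma)
  then have "c * S (x - 1) + (- b - c) * S x + b * S (x + 1) - of_nat j * S x = 0"
    using kraw_term_recurrence_partial[OF assms(1,2) order_refl, of x "of_nat j"]
    unfolding S_def b_def c_def sum_distrib_left sum.distrib[symmetric] sum_subtractf[symmetric]
    by simp
  then show ?thesis by simp
qed

section \<open>The matrices\<close>

lemma mat_dims [simp]:
  "U_mat p N \<in> carrier_mat (Suc N) (Suc N)"
  "B_mat p N \<in> carrier_mat (Suc N) (Suc N)"
  "D_mat N \<in> carrier_mat (Suc N) (Suc N)"
  "K_mat p N \<in> carrier_mat (Suc N) (Suc N)"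
  by (simp_all add: U_mat_def B_mat_def D_mat_def K_mat_def mat_diag_def)

lemma U_mat_index:
  assumes "i \<le> N" "j \<le> N"
  shows "U_mat p N $$ (i, j) = (\<Sum>n = 0..N. kraw_term p N (of_nat i) (of_nat j) n)"
  using assms by (simp add: U_mat_def poly_krawtchouk)

lemma transpose_U_mat: "transpose_mat (U_mat p N) = U_mat p N"
proof (rule eq_matI)
  fix i j assume "i < dim_row (U_mat p N)" "j < dim_col (U_mat p N)"
  then have "i \<le> N" "j \<le> N" by (auto simp: U_mat_def)
  moreover from this have "transpose_mat (U_mat p N) $$ (i, j) = U_mat p N $$ (j, i)"
    by (simp add: U_mat_def)
  ultimately show "transpose_mat (U_mat p N) $$ (i, j) = U_mat p N $$ (i, j)"
    by (simp add: U_mat_index kraw_term_def mult.commute)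
qed (simp_all add: U_mat_def)

lemma transpose_mat_diag: "transpose_mat (mat_diag n f) = mat_diag n f"
  by (rule eq_matI) (auto simp: mat_diag_def)

lemma D_mat_K_mat_commute: "D_mat N * K_mat p N = K_mat p N * D_mat N"
  by (simp add: D_mat_def K_mat_def mult.commute)

lemma sum_tridiagonal:
  fixes l d u :: "nat \<Rightarrow> 'b::comm_ring_1" and N i :: nat
  assumes "i \<le> N" "l 0 = 0" "u N = 0"
  shows "(\<Sum>k = 0..<Suc N. (if i = k + 1 then l i else if i = k then d i
            else if k = i + 1 then u i else 0) * f k)
       = l i * f (i - 1) + d i * f i + u i * f (i + 1)"
proof -
  have "(\<Sum>k = 0..<Suc N. (if i = k + 1 then l i else if i = k then d i
            else if k = i + 1 then u i else 0) * f k)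
      = (\<Sum>k = 0..<Suc N. (if k = i - 1 then if i = 0 then 0 else l i * f (i - 1) else 0)
          + (if k = i then d i * f i else 0) + (if k = i + 1 then u i * f (i + 1) else 0))"
    by (intro sum.cong refl) auto
  also have "\<dots> = l i * f (i - 1) + d i * f i + u i * f (i + 1)"
    unfolding sum.distrib sum.delta[OF finite_atLeastLessThan]
    using assms by (cases "i = N") auto
  finally show ?thesis .
qed

lemma B_mat_U_mat:
  fixes p :: "'a::field"
  assumes "feasible TYPE('a) N" "p \<noteq> 0"
  shows "B_mat p N * U_mat p N = U_mat p N * D_mat N"
proof (rule eq_matI)
  fix i j
  assume "i < dim_row (U_mat p N * D_mat N)" "j < dim_col (U_mat p N * (D_mat N :: 'a mat))"
  then have ij: "i \<le> N" "j \<le> N" by (auto simp: U_mat_def D_mat_def mat_diag_def)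
  define S where "S = (\<lambda>z::'a. \<Sum>n = 0..N. kraw_term p N z (of_nat j) n)"
  have "(B_mat p N * U_mat p N) $$ (i, j)
      = (\<Sum>k = 0..<Suc N. B_mat p N $$ (i, k) * U_mat p N $$ (k, j))"
    using ij by (simp add: scalar_prod_def U_mat_def B_mat_def del: sum.op_ivl_Suc)
  also have "\<dots> = (\<Sum>k = 0..<Suc N. (if i = k + 1 then kraw_c p i else if i = k then kraw_a p N i
            else if k = i + 1 then kraw_b p N i else 0) * S (of_nat k))"
    using ij by (intro sum.cong refl) (auto simp: B_mat_def U_mat_index S_def)
  also have "\<dots> = kraw_c p i * S (of_nat (i - 1)) + kraw_a p N i * S (of_nat i)
      + kraw_b p N i * S (of_nat (i + 1))"
    by (rule sum_tridiagonal[OF ij(1)]) (simp_all add: kraw_c_def kraw_b_def)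
  also have "kraw_c p i * S (of_nat (i - 1)) = kraw_c p i * S (of_nat i - 1)"
    by (cases i) (simp_all add: kraw_c_def)
  also have "kraw_c p i * S (of_nat i - 1) + kraw_a p N i * S (of_nat i)
      + kraw_b p N i * S (of_nat (i + 1)) = of_nat j * S (of_nat i)"
    using kraw_term_recurrence[OF assms ij(2), of "of_nat i"]
    unfolding S_def kraw_a_def kraw_b_def kraw_c_def by (simp add: add.commute)
  also have "\<dots> = (U_mat p N * D_mat N) $$ (i, j)"
    using ij unfolding D_mat_def
    by (subst mat_diag_mult_right[of _ "N + 1"]) (simp_all add: U_mat_index S_def mult.commute)
  finally show "(B_mat p N * U_mat p N) $$ (i, j) = (U_mat p N * D_mat N) $$ (i, j)" .
qed (simp_all add: U_mat_def B_mat_def D_mat_def mat_diag_def)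

lemma kraw_k_detailed_balance:
  fixes p :: "'a::field"
  assumes "p \<noteq> 1" "i < N"
  shows "kraw_k p N i * kraw_b p N i = kraw_k p N (Suc i) * kraw_c p (Suc i)"
proof -
  have "Suc i * (N choose Suc i) = (N - i) * (N choose i)"
    by (simp only: binomial_absorption binomial_absorb_comp)
  then have "(of_nat (Suc i * (N choose Suc i)) :: 'a) = of_nat ((N - i) * (N choose i))"
    by (rule arg_cong)
  then have "(of_nat (Suc i) :: 'a) * of_nat (N choose Suc i) = (of_nat N - of_nat i) * of_nat (N choose i)"
    using assms(2) by (simp only: of_nat_mult of_nat_diff less_imp_le)
  moreover have "kraw_k p N (Suc i) * kraw_c p (Suc i)
      = (of_nat (Suc i) * of_nat (N choose Suc i)) * ((p / (1 - p)) ^ i * (p / (1 - p) * (p - 1)))"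
    unfolding kraw_k_def kraw_c_def power_Suc by (simp only: mult_ac)
  ultimately have "kraw_k p N (Suc i) * kraw_c p (Suc i)
      = ((of_nat N - of_nat i) * of_nat (N choose i)) * ((p / (1 - p)) ^ i * (p / (1 - p) * (p - 1)))"
    by (simp only:)
  also have "p / (1 - p) * (p - 1) = - p"
    using assms(1) by (simp add: field_simps)
  finally show ?thesis by (simp add: kraw_k_def kraw_b_def algebra_simps)
qed

lemma transpose_B_mat_K_mat:
  fixes p :: "'a::field"
  assumes "p \<noteq> 1"
  shows "transpose_mat (B_mat p N) * K_mat p N = K_mat p N * B_mat p N"
  unfolding K_mat_def
  apply (subst mat_diag_mult_right[of _ "N + 1"], simp add: B_mat_def)
  apply (subst mat_diag_mult_left[of _ _ "N + 1"], simp add: B_mat_def)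
  apply (rule eq_matI)
  using kraw_k_detailed_balance[OF assms, of _ N]
  by (auto simp: B_mat_def mult.commute)

lemma kraw_k_neq_0:
  fixes p :: "'a::field"
  assumes "feasible TYPE('a) N" "p \<noteq> 0" "p \<noteq> 1" "i \<le> N"
  shows "kraw_k p N i \<noteq> 0"
  using assms feasible_binomial_neq_0[OF assms(1,4)] by (simp add: kraw_k_def)

lemma K_mat_inverse:
  fixes p :: "'a::field"
  assumes "feasible TYPE('a) N" "p \<noteq> 0" "p \<noteq> 1"
  obtains K' where "mat_inverse (K_mat p N) = Some K'" "K' \<in> carrier_mat (Suc N) (Suc N)"
    "K_mat p N * K' = 1\<^sub>m (Suc N)" "K' * K_mat p N = 1\<^sub>m (Suc N)"
proof -
  define L :: "'a mat" where "L = mat_diag (N + 1) (\<lambda>i. inverse (kraw_k p N i))"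
  have L: "L \<in> carrier_mat (Suc N) (Suc N)" by (simp add: L_def mat_diag_def)
  have "K_mat p N * L = 1\<^sub>m (Suc N)" "L * K_mat p N = 1\<^sub>m (Suc N)"
    using kraw_k_neq_0[OF assms] unfolding L_def K_mat_def mat_diag_diag
    by (auto simp: mat_diag_def intro!: eq_matI)
  with L have "K_mat p N \<in> Units (ring_mat TYPE('a) (Suc N) ())"
    by (auto simp: Units_def ring_mat_def)
  then have "mat_inverse (K_mat p N) \<noteq> None"
    using mat_inverse(1)[OF mat_dims(4), of p N "()"] by blast
  with that mat_inverse(2)[OF mat_dims(4), of p N] show ?thesis by auto
qed

lemma sum_kraw_k:
  fixes p :: "'a::field"
  assumes "p \<noteq> 1"
  shows "(\<Sum>i\<le>N. kraw_k p N i) = (1 - p) powi (- int N)"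
proof -
  have "(\<Sum>i\<le>N. kraw_k p N i) = (p / (1 - p) + 1) ^ N"
    by (simp add: binomial_ring kraw_k_def)
  also have "p / (1 - p) + 1 = inverse (1 - p)"
    using assms by (simp add: field_simps)
  finally show ?thesis by (simp add: power_int_minus power_inverse)
qed

lemma commute_D_mat_B_mat_scalar:
  fixes p :: "'a::field"
  assumes "feasible TYPE('a) N" "p \<noteq> 0"
    and "E \<in> carrier_mat (Suc N) (Suc N)"
    and "E * D_mat N = D_mat N * E" "E * B_mat p N = B_mat p N * E"
  shows "E = (E $$ (0, 0)) \<cdot>\<^sub>m 1\<^sub>m (Suc N)"
proof -
  have off: "E $$ (i, j) = 0" if "i \<le> N" "j \<le> N" "i \<noteq> j" for i j
  proof -
    have "(E * D_mat N) $$ (i, j) = E $$ (i, j) * of_nat j"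
      unfolding D_mat_def using that assms(3) by (subst mat_diag_mult_right[of _ "N + 1"]) auto
    moreover have "(D_mat N * E) $$ (i, j) = of_nat i * E $$ (i, j)"
      unfolding D_mat_def using that assms(3)
      by (subst mat_diag_mult_left[of _ _ "N + 1"]) auto
    ultimately have "E $$ (i, j) * of_nat j = of_nat i * E $$ (i, j)"
      unfolding assms(4) by (simp only:)
    then have "(of_nat j - of_nat i) * E $$ (i, j) = 0"
      by (simp only: left_diff_distrib mult.commute[of "of_nat j"] diff_self)
    then show ?thesis
      using feasible_of_nat_eq_iff[OF assms(1) that(1,2)] that(3) by simp
  qed
  define d where "d = (\<lambda>i. E $$ (i, i))"
  have E: "E = mat_diag (N + 1) d"
    using assms(3) off by (intro eq_matI) (auto simp: mat_diag_def d_def)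
  have step: "d (Suc i) = d i" if "i < N" for i
  proof -
    have "(E * B_mat p N) $$ (i, Suc i) = d i * B_mat p N $$ (i, Suc i)"
      unfolding E by (subst mat_diag_mult_left[of _ _ "N + 1"]) (use that in \<open>auto simp: B_mat_def\<close>)
    moreover have "(B_mat p N * E) $$ (i, Suc i) = B_mat p N $$ (i, Suc i) * d (Suc i)"
      unfolding E by (subst mat_diag_mult_right[of _ "N + 1"]) (use that in \<open>auto simp: B_mat_def\<close>)
    moreover have "B_mat p N $$ (i, Suc i) \<noteq> 0"
      using that assms(2) feasible_of_nat_eq_iff[OF assms(1), of i N]
      by (simp add: B_mat_def kraw_b_def)
    ultimately show ?thesis using assms(5) by auto
  qed
  define e where "e = E $$ (0, 0)"
  have "E $$ (i, i) = e" if "i \<le> N" for i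
    using that by (induction i) (auto simp: e_def step[unfolded d_def])
  with off assms(3) show ?thesis
    unfolding e_def[symmetric] by (intro eq_matI) auto
qed

lemma U_mat_border:
  assumes "j \<le> N"
  shows "U_mat p N $$ (0, j) = 1" "U_mat p N $$ (j, 0) = 1"
proof -
  have *: "kraw_term p N 0 x n = (if n = 0 then 1 else 0)"
    "kraw_term p N x 0 n = (if n = 0 then 1 else 0)" for x :: 'a and n
    by (simp_all add: kraw_term_def pochhammer_0_left)
  show "U_mat p N $$ (0, j) = 1" "U_mat p N $$ (j, 0) = 1"
    using assms by (simp_all add: U_mat_index *)
qed

lemma UK_square_0_0:
  fixes p :: "'a::field" and N :: nat
  assumes "p \<noteq> 1"
  defines "P \<equiv> U_mat p N * K_mat p N"
  shows "(P * P) $$ (0, 0) = (1 - p) powi (- int N)"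
proof -
  have P: "P \<in> carrier_mat (Suc N) (Suc N)" unfolding P_def by (rule mult_carrier_mat[of _ _ "Suc N"]) auto
  have idx: "P $$ (i, j) = U_mat p N $$ (i, j) * kraw_k p N j" if "i \<le> N" "j \<le> N" for i j
    unfolding P_def K_mat_def using that by (subst mat_diag_mult_right[of _ "N + 1"]) auto
  have "(P * P) $$ (0, 0) = (\<Sum>k = 0..<Suc N. P $$ (0, k) * P $$ (k, 0))"
    using P by (simp add: scalar_prod_def del: sum.op_ivl_Suc)
  also have "\<dots> = (\<Sum>k = 0..<Suc N. kraw_k p N k)"
    by (intro sum.cong refl) (simp add: idx U_mat_border, simp add: kraw_k_def)
  also have "{0..<Suc N} = {..N}" by auto
  finally show ?thesis using sum_kraw_k[OF assms(1)] by simp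
qed

theorem theorem4p5:
  fixes p :: "'a::alg_closed_field" and N :: nat and U B D K P :: "'a mat"
  assumes "CHAR('a) \<noteq> 2"
    and "p \<noteq> 0" and "p \<noteq> 1"
    and "feasible TYPE('a) N"
    and "U = U_mat p N" and "B = B_mat p N" and "D = D_mat N" and "K = K_mat p N"
    and "P = U * K"
  shows "invertible_mat K
    \<and> transpose_mat P = K * P * the (mat_inverse K)
    \<and> transpose_mat B = K * B * the (mat_inverse K)
    \<and> P * D = B * P
    \<and> P * B = D * P
    \<and> P ^\<^sub>m 2 = ((1 - p) powi (- int N)) \<cdot>\<^sub>m 1\<^sub>m (N + 1)"
proof -
  let ?n = "Suc N"
  have car [simp]: "U \<in> carrier_mat ?n ?n" "B \<in> carrier_mat ?n ?n" "D \<in> carrier_mat ?n ?n"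
    "K \<in> carrier_mat ?n ?n" "P \<in> carrier_mat ?n ?n"
    using assms by (auto intro: mult_carrier_mat[of _ _ "Suc N"])
  obtain K' where K': "mat_inverse K = Some K'" and carK' [simp]: "K' \<in> carrier_mat ?n ?n"
    and KK': "K * K' = 1\<^sub>m ?n" "K' * K = 1\<^sub>m ?n"
    using K_mat_inverse[OF assms(4,2,3)] assms(8) by metis
  have Kt: "transpose_mat K = K" and Dt: "transpose_mat D = D"
    by (simp_all add: assms K_mat_def D_mat_def transpose_mat_diag)
  have Ut: "transpose_mat U = U" by (simp add: assms transpose_U_mat)
  have Pt: "transpose_mat P = K * U"
    unfolding assms(9) by (subst transpose_mult[of _ ?n ?n _ ?n]) (simp_all add: Ut Kt)
  have DK: "D * K = K * D" by (simp add: assms D_mat_K_mat_commute)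
  have BU: "B * U = U * D" using B_mat_U_mat[OF assms(4,2)] by (simp add: assms)
  have BK: "transpose_mat B * K = K * B" using transpose_B_mat_K_mat[OF assms(3)] by (simp add: assms)
  note mult_carrier_mat[of _ ?n ?n _ ?n, simp]
  note assoc = assoc_mult_mat[of _ ?n ?n _ ?n _ ?n]
  have 0: "invertible_mat K"
    unfolding invertible_mat_def inverts_mat_def using KK' carrier_matD[OF car(4)]
      carrier_matD[OF carK'] by auto
  have KPK': "K * P * K' = K * U"
  proof -
    have "K * P * K' = K * U * (K * K')"
      unfolding assms(9) by (simp add: assoc)
    then show ?thesis by (simp add: KK' right_mult_one_mat[of _ ?n ?n])
  qed
  have iii: "P * D = B * P"
  proof -
    have "P * D = U * (D * K)" unfolding assms(9) DK by (simp add: assoc)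
    also have "\<dots> = B * U * K" unfolding BU by (simp add: assoc)
    finally show ?thesis unfolding assms(9) by (simp add: assoc)
  qed
  have iv: "P * B = D * P"
  proof -
    have "transpose_mat (B * U) = transpose_mat (U * D)" by (simp add: BU)
    then have "U * transpose_mat B = D * U"
      by (simp add: transpose_mult[of _ ?n ?n _ ?n] Ut Dt)
    moreover have "P * B = U * (transpose_mat B * K)"
      unfolding assms(9) BK by (simp add: assoc)
    ultimately have "P * B = D * U * K" by (simp flip: assoc)
    then show ?thesis unfolding assms(9) by (simp add: assoc)
  qed
  have ii: "transpose_mat B = K * B * K'"
  proof -
    have "K * B * K' = transpose_mat B * (K * K')" by (simp flip: BK add: assoc)
    then show ?thesis by (simp add: KK' right_mult_one_mat[of _ ?n ?n])
  qed
  have "P * P * D = P * (B * P)" by (simp add: assoc iii)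
  also have "\<dots> = D * (P * P)" by (simp add: iv flip: assoc)
  finally have PPD: "P * P * D = D * (P * P)" .
  have "P * P * B = P * (D * P)" by (simp add: assoc iv)
  also have "\<dots> = B * (P * P)" by (simp add: iii flip: assoc)
  finally have PPB: "P * P * B = B * (P * P)" .
  have "P * P = ((P * P) $$ (0, 0)) \<cdot>\<^sub>m 1\<^sub>m ?n"
    by (rule commute_D_mat_B_mat_scalar[OF assms(4,2)])
      (use PPD PPB in \<open>simp_all add: assms(6,7)\<close>)
  also have "(P * P) $$ (0, 0) = (1 - p) powi (- int N)"
    using UK_square_0_0[OF assms(3), of N] by (simp add: assms)
  finally have "P ^\<^sub>m 2 = ((1 - p) powi (- int N)) \<cdot>\<^sub>m 1\<^sub>m (N + 1)"
    using left_mult_one_mat[OF car(5)] car(5) by (simp add: numeral_2_eq_2)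
  with 0 Pt KPK' ii iii iv K' show ?thesis by simp
qed

end
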